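(* Let $0<\alpha,\beta<1$, let $g\in H_\alpha([0,1])$, and let $[c,d]$ be a compact interval with $g([0,1])\subset[c,d]$. Then the integral $\int_a^b f(t,g(t))\,dg(t)$, $0\le a<b\le1$, exists for every continuous function $f:[0,1]\times\mathbb{R}\to\mathbb{R}$ with $\sup_{x\in[c,d]}|f(\cdot,x),H_\beta([0,1])|<\infty$ if and only if $$\sum_{k=1}^{\infty}2^{k(1-\beta)}|B_{k-1}(g)|<\infty .$$
   Context: For $0<\beta\le1$, $H_\beta([0,1])$ is the class of functions with finite seminorm $|f,H_\beta([0,1])|=\sup_{s\ne t\in[0,1]}|f(s)-f(t)|/|s-t|^\beta$. For $g\in C([0,1])$ put $t_{k,n}=n2^{-k}$ and $h_{k,n}=h_{k,n}(g)=2^k\int_{t_{k,n}}^{t_{k,n+1}}g(\tau)\,d\tau$ for $k\ge0$, $0\le n<2^k$. For $0\le a<b\le1$ and $k\ge1$ let $n_k(a)$ and $n_k(b)$ be the smallest and the largest element of the set of consecutive integers $\{n:\ 0\le n\le 2^k,\ [t_{k-1,\lfloor n/2\rfloor},t_{k-1,\lfloor n/2\rfloor+1}]\subset[a,b]\}$ (if this set is empty, the sum below is $0$). By definition, $$\int_a^b f(t,g(t))\,dg(t)=\lim_{k\to\infty}\sum_{n=n_k(a)+1}^{n_k(b)}\int_{h_{k,n-1}}^{h_{k,n}}f(t_{k,n},x)\,dx,$$ and the integral exists if this limit exists (finite). $|B_k(g)|$ is the (unsigned) area between the polygonal step curves with heights $h_{k,n}(g)$ and $h_{k+1,n}(g)$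 over the dyadic intervals of levels $k$ and $k+1$ of $[0,1]$, i.e. $|B_k(g)|=2^{-(k+1)}\sum_{n=0}^{2^k-1}|h_{k+1,2n+1}(g)-h_{k+1,2n}(g)|$, $k\ge0$. *)

theory Defs
  imports "HOL-Analysis.Analysis"
begin

text \<open>The Hoelder seminorm of a function on the unit interval, with values in
  \<open>[0,\<infinity>]\<close>; values of the function outside \<open>[0,1]\<close> are irrelevant.\<close>

definition holder_seminorm :: "real \<Rightarrow> (real \<Rightarrow> real) \<Rightarrow> ennreal" where
  "holder_seminorm \<beta> f =
     (SUP (s, t) \<in> {(s, t). s \<in> {0..1} \<and> t \<in> {0..1} \<and> s \<noteq> t}.
        ennreal (\<bar>f s - f t\<bar> / \<bar>s - t\<bar> powr \<beta>))"

definition holder_class :: "real \<Rightarrow> (real \<Rightarrow> real) set" where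
  "holder_class \<beta> = {f. holder_seminorm \<beta> f < \<infinity>}"

definition dyadic :: "nat \<Rightarrow> nat \<Rightarrow> real" where
  "dyadic k n = real n / 2 ^ k"

definition height :: "(real \<Rightarrow> real) \<Rightarrow> nat \<Rightarrow> nat \<Rightarrow> real" where
  "height g k n = 2 ^ k * integral {dyadic k n..dyadic k (n + 1)} g"

text \<open>\<open>dyadic_indices\<close> and \<open>dyadic_sum\<close> are meaningful for \<open>k \<ge> 1\<close> only; their value
  at \<open>k = 0\<close>, where \<open>k - 1\<close> is truncated, has no influence on the limit below.
  An index \<open>n = 2 ^ k\<close> never satisfies the inclusion when \<open>b \<le> 1\<close>, so that the heights
  occurring in the sum are averages of \<open>g\<close> over subintervals of \<open>[0,1]\<close>.\<close>

definition dyadic_indices :: "real \<Rightarrow> real \<Rightarrow> nat \<Rightarrow> nat set" where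
  "dyadic_indices a b k =
     {n. n \<le> 2 ^ k \<and> {dyadic (k - 1) (n div 2)..dyadic (k - 1) (n div 2 + 1)} \<subseteq> {a..b}}"

text \<open>The inner integral is oriented: it changes sign if the upper limit is below the
  lower one.\<close>

definition dyadic_sum ::
    "(real \<times> real \<Rightarrow> real) \<Rightarrow> (real \<Rightarrow> real) \<Rightarrow> real \<Rightarrow> real \<Rightarrow> nat \<Rightarrow> real" where
  "dyadic_sum f g a b k =
     (if dyadic_indices a b k = {} then 0
      else \<Sum>n = Min (dyadic_indices a b k) + 1..Max (dyadic_indices a b k).
             (LBINT x=height g k (n - 1)..height g k n. f (dyadic k n, x)))"

definition has_dyadic_integral ::
    "(real \<times> real \<Rightarrow> real) \<Rightarrow> (real \<Rightarrow> real) \<Rightarrow> real \<Rightarrow> real \<Rightarrow> real \<Rightarrow> bool" where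
  "has_dyadic_integral f g a b I \<longleftrightarrow> dyadic_sum f g a b \<longlonglongrightarrow> I"

definition dyadic_integral_exists ::
    "(real \<times> real \<Rightarrow> real) \<Rightarrow> (real \<Rightarrow> real) \<Rightarrow> real \<Rightarrow> real \<Rightarrow> bool" where
  "dyadic_integral_exists f g a b \<longleftrightarrow> (\<exists>I. has_dyadic_integral f g a b I)"

text \<open>The area between the step curves of levels \<open>k\<close> and \<open>k + 1\<close>: as \<open>height g k n\<close> is the
  mean of \<open>height g (k + 1) (2 * n)\<close> and \<open>height g (k + 1) (2 * n + 1)\<close>, each of the
  two halves of the \<open>n\<close>-th interval contributes half of the \<open>n\<close>-th summand.\<close>

definition step_area :: "(real \<Rightarrow> real) \<Rightarrow> nat \<Rightarrow> real" where
  "step_area g k =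
     (\<Sum>n<2 ^ k. \<bar>height g (k + 1) (2 * n + 1) - height g (k + 1) (2 * n)\<bar>) / 2 ^ (k + 1)"

end

theory Submission imports Defs begin

text \<open>
  Write \<open>F t x\<close> for the integral of \<open>f (t, \<cdot>)\<close> from \<open>c\<close> to \<open>x\<close>. A term of the dyadic sum is then
  \<open>F t\<^sub>n h\<^sub>n - F t\<^sub>n h\<^sub>n\<^sub>-\<^sub>1\<close>, and summation by parts moves the difference from the second
  argument to the first: the dyadic sum equals a boundary term, which converges because
  \<open>F\<close> is continuous and the heights converge to \<open>g\<close>, minus the cell sum of the increments
  \<open>F t\<^sub>n\<^sub>+\<^sub>1 h\<^sub>n - F t\<^sub>n h\<^sub>n\<close>. So the integral exists if and only if the cell sums converge
  (\<open>integral_exists_iff\<close>).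

  If a cell is halved, then its increment splits into the increments over its halves, at the old
  height. Replacing the old height by the two new ones changes them by rectangle increments of
  \<open>F\<close>, and such a rectangle is at most \<open>C\<close> times its width to the power \<open>\<beta>\<close> times its height.
  Summed over all cells this is at most \<open>C 2\<^bsup>(m+1)(1-\<beta>)\<^esup>\<close> times the area between the step curves of the
  levels \<open>m\<close> and \<open>m + 1\<close>. Moreover, at most two cells of level \<open>m + 1\<close> lie in \<open>[a,b]\<close> without their
  parents, which costs a geometric term. Hence the cell sums form a Cauchy sequence if
  the series of weighted areas converges (\<open>integral_exists\<close>).

  For the converse, an integrand that depends on \<open>t\<close> alone suffices. If \<open>f (t, x) = \<phi> t\<close>, then the
  step from level \<open>m\<close> to level \<open>m + 1\<close> only sees the second differences of \<open>\<phi>\<close> on the cells of level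
  \<open>m\<close>, multiplied by half the jump of the heights in that cell. A Schauder (Takagi type) series
  \<open>\<phi>\<close> with tents of height \<open>2\<^bsup>-(m+1)\<beta>\<^esup>\<close> over the cells of level \<open>m\<close> is Hoelder continuous with
  exponent \<open>\<beta> < 1\<close>, its second differences at level \<open>m\<close> come from the tents of level \<open>m\<close> alone, and
  the sign of each tent can be that of the jump. With this choice the cell sums are, up to a
  constant, exactly the negative partial sums of the series of weighted areas
  (\<open>schauder_test_integrand\<close>).
\<close>

section \<open>Hoelder seminorms\<close>

lemma holder_seminorm_le_iff:
  assumes "C \<ge> 0"
  shows "holder_seminorm \<beta> f \<le> ennreal C \<longleftrightarrow>
    (\<forall>s\<in>{0..1}. \<forall>t\<in>{0..1}. \<bar>f s - f t\<bar> \<le> C * \<bar>s - t\<bar> powr \<beta>)"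
proof -
  have "ennreal (\<bar>f s - f t\<bar> / \<bar>s - t\<bar> powr \<beta>) \<le> ennreal C \<longleftrightarrow>
      \<bar>f s - f t\<bar> \<le> C * \<bar>s - t\<bar> powr \<beta>" if "s \<noteq> t" for s t
    using that assms by (simp add: pos_divide_le_eq)
  then have "holder_seminorm \<beta> f \<le> ennreal C \<longleftrightarrow>
      (\<forall>s\<in>{0..1}. \<forall>t\<in>{0..1}. s \<noteq> t \<longrightarrow> \<bar>f s - f t\<bar> \<le> C * \<bar>s - t\<bar> powr \<beta>)"
    unfolding holder_seminorm_def SUP_le_iff by (auto simp del: atLeastAtMost_iff)
  moreover have "\<bar>f t - f t\<bar> \<le> C * \<bar>t - t\<bar> powr \<beta>" for t
    by simp
  ultimately show ?thesis
    by metis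
qed

lemma uniform_holder_constant:
  assumes "(SUP x\<in>X. holder_seminorm \<beta> (f x)) < \<infinity>"
  obtains C where "C \<ge> 0"
    and "\<And>x s t. x \<in> X \<Longrightarrow> s \<in> {0..1} \<Longrightarrow> t \<in> {0..1} \<Longrightarrow> \<bar>f x s - f x t\<bar> \<le> C * \<bar>s - t\<bar> powr \<beta>"
proof -
  obtain C where C: "C \<ge> 0" "(SUP x\<in>X. holder_seminorm \<beta> (f x)) = ennreal C"
    using assms by (cases "SUP x\<in>X. holder_seminorm \<beta> (f x)") auto
  have "holder_seminorm \<beta> (f x) \<le> ennreal C" if "x \<in> X" for x
    unfolding C(2)[symmetric] by (rule SUP_upper[OF that])
  then show thesis
    using that[of C] C(1) holder_seminorm_le_iff by blast
qed

lemma continuous_on_holder: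
  fixes f :: "real \<Rightarrow> real"
  assumes "\<beta> > 0" and "\<And>s t. s \<in> S \<Longrightarrow> t \<in> S \<Longrightarrow> \<bar>f s - f t\<bar> \<le> C * \<bar>s - t\<bar> powr \<beta>"
  shows "continuous_on S f"
  unfolding continuous_on_def
proof
  fix t assume t: "t \<in> S"
  have "((\<lambda>s. C * \<bar>s - t\<bar> powr \<beta>) \<longlongrightarrow> C * \<bar>t - t\<bar> powr \<beta>) (at t within S)"
    using \<open>\<beta> > 0\<close> by (intro tendsto_intros) auto
  then have lim: "((\<lambda>s. C * \<bar>s - t\<bar> powr \<beta>) \<longlongrightarrow> 0) (at t within S)"
    using \<open>\<beta> > 0\<close> by simp
  have "((\<lambda>s. f s - f t) \<longlongrightarrow> 0) (at t within S)"
    by (rule Lim_null_comparison[OF _ lim]) (use assms t in \<open>auto simp: eventually_at_filter\<close>)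
  then show "(f \<longlongrightarrow> f t) (at t within S)"
    using LIM_zero_iff by blast
qed

section \<open>Dyadic cells and the heights over them\<close>

lemma inverse_power_two_powr: "(1 / 2 ^ k) powr \<beta> = (2 powr - \<beta>) ^ k" for \<beta> :: real
proof -
  have "1 / 2 ^ k = (2::real) powr - real k"
    by (simp add: powr_minus_divide powr_realpow)
  then show ?thesis
    by (simp add: powr_powr powr_power)
qed

lemma dyadic_double: "dyadic (Suc k) (2 * n) = dyadic k n"
  by (simp add: dyadic_def)

lemma dyadic_in_unit: "n \<le> 2 ^ k \<Longrightarrow> dyadic k n \<in> {0..1}"
  by (simp add: dyadic_def)

lemma dyadic_le_Suc: "dyadic k n \<le> dyadic k (Suc n)"
  by (simp add: dyadic_def divide_right_mono)

lemma dyadic_Suc_diff: "dyadic k (Suc n) - dyadic k n = 1 / 2 ^ k"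
  by (simp add: dyadic_def diff_divide_distrib[symmetric])

lemma dyadic_cell_subset:
  assumes "n < 2 ^ k"
  shows "{dyadic k n..dyadic k (Suc n)} \<subseteq> {0..1}"
  using dyadic_in_unit[of n k] dyadic_in_unit[of "Suc n" k] assms by auto

text \<open>Averages inherit two-sided bounds. With constants \<open>c\<close> and \<open>d\<close> this keeps the heights in
  \<open>[c,d]\<close>, where the Hoelder bound on the integrand is available; with \<open>g t \<plusminus> e\<close> it makes
  the heights converge.\<close>

lemma height_between:
  assumes "continuous_on {0..1} g" "n < 2 ^ k"
    and "\<And>u. u \<in> {dyadic k n..dyadic k (Suc n)} \<Longrightarrow> A \<le> g u \<and> g u \<le> B"
  shows "A \<le> height g k n" "height g k n \<le> B"
proof -
  let ?I = "{dyadic k n..dyadic k (Suc n)}"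
  have int: "g integrable_on ?I"
    using continuous_on_subset[OF assms(1) dyadic_cell_subset[OF assms(2)]]
    by (rule integrable_continuous_real)
  have "integral ?I (\<lambda>_. A) \<le> integral ?I g" "integral ?I g \<le> integral ?I (\<lambda>_. B)"
    using assms(3) by (intro integral_le int integrable_const_ivl; blast)+
  then show "A \<le> height g k n" "height g k n \<le> B"
    using dyadic_le_Suc[of k n] dyadic_Suc_diff[of k n]
    by (simp_all add: height_def field_simps)
qed

lemma height_is_mean:
  assumes "continuous_on {0..1} g" "n < 2 ^ k"
  shows "height g k n = (height g (Suc k) (2 * n) + height g (Suc k) (2 * n + 1)) / 2"
proof -
  have e: "dyadic (Suc k) (2 * n + 2) = dyadic k (Suc n)"
    using dyadic_double[of k "Suc n"] by simp
  have int: "g integrable_on {dyadic k n..dyadic k (Suc n)}"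
    using continuous_on_subset[OF assms(1) dyadic_cell_subset[OF assms(2)]]
    by (rule integrable_continuous_real)
  have "integral {dyadic k n..dyadic (Suc k) (2 * n + 1)} g
      + integral {dyadic (Suc k) (2 * n + 1)..dyadic k (Suc n)} g
      = integral {dyadic k n..dyadic k (Suc n)} g"
  proof (rule Henstock_Kurzweil_Integration.integral_combine[OF _ _ int])
    show "dyadic k n \<le> dyadic (Suc k) (2 * n + 1)"
      using dyadic_le_Suc[of "Suc k" "2 * n"] by (simp add: dyadic_double)
    show "dyadic (Suc k) (2 * n + 1) \<le> dyadic k (Suc n)"
      using dyadic_le_Suc[of "Suc k" "2 * n + 1"] e by simp
  qed
  then show ?thesis
    using e by (simp add: height_def dyadic_double flip: distrib_left)
qed

section \<open>Schauder series\<close>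

text \<open>A tent of height 1 over each interval \<open>[n, n + 1]\<close>, scaled by \<open>\<epsilon> n\<close>.\<close>

definition signed_tents :: "(nat \<Rightarrow> real) \<Rightarrow> real \<Rightarrow> real" where
  "signed_tents \<epsilon> x = \<epsilon> (nat \<lfloor>x\<rfloor>) * (2 * min (frac x) (1 - frac x))"

lemma signed_tents_of_nat [simp]: "signed_tents \<epsilon> (real n) = 0"
  by (simp add: signed_tents_def frac_def)

lemma signed_tents_up:
  assumes "real l \<le> x" "x \<le> real l + 1 / 2"
  shows "signed_tents \<epsilon> x = \<epsilon> l * (2 * (x - real l))"
proof -
  have "\<lfloor>x\<rfloor> = int l" using assms by (simp add: floor_eq_iff)
  then show ?thesis using assms by (simp add: signed_tents_def frac_def)
qed

lemma signed_tents_down: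
  assumes "real l + 1 / 2 \<le> x" "x \<le> real l + 1"
  shows "signed_tents \<epsilon> x = \<epsilon> l * (2 * (real l + 1 - x))"
proof (cases "x = real l + 1")
  case True
  then have "x = real (Suc l)" by simp
  then show ?thesis using True by (simp only: signed_tents_of_nat) simp
next
  case False
  then have "\<lfloor>x\<rfloor> = int l" using assms by (simp add: floor_eq_iff)
  then show ?thesis using assms by (simp add: signed_tents_def frac_def)
qed

text \<open>On half-integer cells the function is affine; the midpoint identity is the form of this
  that makes second differences vanish.\<close>

lemma signed_tents_midpoint:
  assumes "real m / 2 \<le> x" "x \<le> real (Suc m) / 2" "real m / 2 \<le> y" "y \<le> real (Suc m) / 2"
  shows "signed_tents \<epsilon> x + signed_tents \<epsilon> y = 2 * signed_tents \<epsilon> ((x + y) / 2)"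
proof (cases "even m")
  case True
  then obtain l where "m = 2 * l" by (elim evenE)
  then show ?thesis
    using assms signed_tents_up[of l x \<epsilon>] signed_tents_up[of l y \<epsilon>] signed_tents_up[of l "(x + y) / 2" \<epsilon>]
    by (simp add: field_simps)
next
  case False
  then obtain l where "m = 2 * l + 1" by (elim oddE)
  then show ?thesis
    using assms signed_tents_down[of l x \<epsilon>] signed_tents_down[of l y \<epsilon>] signed_tents_down[of l "(x + y) / 2" \<epsilon>]
    by (simp add: field_simps)
qed

lemma abs_signed_tents:
  fixes x :: real
  assumes "\<And>n. \<bar>\<epsilon> n\<bar> \<le> 1"
  shows "\<bar>signed_tents \<epsilon> x\<bar> \<le> 1"
    "\<bar>signed_tents \<epsilon> x\<bar> \<le> 2 * (x - \<lfloor>x\<rfloor>)" "\<bar>signed_tents \<epsilon> x\<bar> \<le> 2 * (\<lfloor>x\<rfloor> + 1 - x)"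
proof -
  have tent: "0 \<le> min (frac x) (1 - frac x)"
    using frac_ge_0[of x] frac_lt_1[of x] by simp
  then have *: "\<bar>signed_tents \<epsilon> x\<bar> \<le> 2 * min (frac x) (1 - frac x)"
    using mult_right_mono[OF assms[of "nat \<lfloor>x\<rfloor>"], of "2 * min (frac x) (1 - frac x)"]
    by (simp only: signed_tents_def abs_mult) simp
  show "\<bar>signed_tents \<epsilon> x\<bar> \<le> 1" "\<bar>signed_tents \<epsilon> x\<bar> \<le> 2 * (x - \<lfloor>x\<rfloor>)"
    "\<bar>signed_tents \<epsilon> x\<bar> \<le> 2 * (\<lfloor>x\<rfloor> + 1 - x)"
    using * unfolding frac_def by (simp_all add: min_def split: if_splits)
qed

text \<open>Across different intervals \<open>[n, n + 1]\<close> the signs may change, but the function vanishes at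
  the integer points in between, so the distance to these points bounds both values.\<close>

lemma signed_tents_lipschitz:
  assumes "\<And>n. \<bar>\<epsilon> n\<bar> \<le> 1"
  shows "\<bar>signed_tents \<epsilon> x - signed_tents \<epsilon> y\<bar> \<le> 2 * \<bar>x - y\<bar>"
proof (induction x y rule: linorder_wlog)
  case (le x y)
  show ?case
  proof (cases "\<lfloor>x\<rfloor> = \<lfloor>y\<rfloor>")
    case True
    let ?D = "2 * min (frac x) (1 - frac x) - 2 * min (frac y) (1 - frac y)"
    have "signed_tents \<epsilon> x - signed_tents \<epsilon> y = \<epsilon> (nat \<lfloor>y\<rfloor>) * ?D"
      by (simp only: signed_tents_def True right_diff_distrib)
    then have "\<bar>signed_tents \<epsilon> x - signed_tents \<epsilon> y\<bar> = \<bar>\<epsilon> (nat \<lfloor>y\<rfloor>)\<bar> * \<bar>?D\<bar>"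
      by (simp only: abs_mult)
    also have "\<dots> \<le> \<bar>?D\<bar>"
      using mult_right_mono[OF assms[of "nat \<lfloor>y\<rfloor>"], of "\<bar>?D\<bar>"] by simp
    also have "\<dots> \<le> 2 * \<bar>x - y\<bar>"
      by (simp add: frac_def True min_def abs_if)
    finally show ?thesis .
  next
    case False
    then have "\<lfloor>x\<rfloor> + 1 \<le> \<lfloor>y\<rfloor>"
      using floor_mono[OF le] by linarith
    then have "real_of_int \<lfloor>x\<rfloor> + 1 \<le> real_of_int \<lfloor>y\<rfloor>"
      by linarith
    then show ?thesis
      using abs_signed_tents(3)[of \<epsilon> x] abs_signed_tents(2)[of \<epsilon> y] assms le by force
  qed
next
  case (sym x y)
  then show ?case by (simp add: abs_minus_commute)
qed

lemma dyadic_magnitude: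
  fixes h :: real
  assumes "0 < h" "h \<le> 1"
  obtains N where "h * 2 ^ N \<le> 1" "1 < h * 2 ^ (N + 1)"
proof -
  obtain n where n: "1 / h < 2 ^ n"
    using real_arch_pow[of 2 "1 / h"] by auto
  define M where "M = (LEAST n. 1 / h < 2 ^ n)"
  have M: "1 / h < 2 ^ M" "\<And>i. i < M \<Longrightarrow> \<not> 1 / h < 2 ^ i"
    unfolding M_def using LeastI[of "\<lambda>n. 1 / h < 2 ^ n", OF n] not_less_Least by blast+
  then obtain N where N: "M = Suc N"
    using assms by (cases M) (auto simp: field_simps)
  with M(1) M(2)[of N] assms show thesis
    by (intro that[of N]) (auto simp: field_simps)
qed

text \<open>The usual trade-off behind the Hoelder continuity of lacunary series: for \<open>h \<approx> 2\<^bsup>-N\<^esup>\<close>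
  the first \<open>N\<close> terms are estimated by their Lipschitz constants, the others by their size. Both
  parts are geometric sums that are dominated by their terms near \<open>N\<close>, because
  \<open>q < 1 < 2 * q\<close>.\<close>

lemma two_scale_sum_bound:
  fixes u :: "nat \<Rightarrow> real"
  assumes q: "0 < q" "q < 1" "1 < 2 * q" and N: "0 \<le> h" "h * 2 ^ N \<le> 1"
    and coarse: "\<And>k. \<bar>u k\<bar> \<le> q ^ (k + 1) * (2 ^ (k + 1) * h)"
    and fine: "\<And>k. \<bar>u k\<bar> \<le> 2 * q ^ (k + 1)"
  shows "summable u" "\<bar>suminf u\<bar> \<le> (2 / (2 * q - 1) + 2 / (1 - q)) * q ^ (N + 1)"
proof -
  have sm: "summable (\<lambda>k. 2 * q ^ (k + 1))"
    using q summable_mult[OF summable_geometric[of q], of "2 * q"] by (simp add: mult.assoc)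
  then show su: "summable u"
    by (rule summable_comparison_test'[of _ 0]) (use fine in auto)
  have "\<bar>\<Sum>k<N. u k\<bar> \<le> (\<Sum>k<N. 2 * q * h * (2 * q) ^ k)"
    using coarse by (intro order_trans[OF sum_abs] sum_mono) (auto simp: power_mult_distrib mult_ac)
  also have "\<dots> = 2 * q * h * (((2 * q) ^ N - 1) / (2 * q - 1))"
    using q geometric_sum[of "2 * q" N] by (simp only: sum_distrib_left[symmetric])
  also have "\<dots> \<le> 2 * q * h * ((2 * q) ^ N / (2 * q - 1))"
    using q N by (intro mult_left_mono divide_right_mono) auto
  also have "\<dots> = 2 / (2 * q - 1) * q ^ (N + 1) * (h * 2 ^ N)"
    by (simp add: power_mult_distrib)
  also have "\<dots> \<le> 2 / (2 * q - 1) * q ^ (N + 1)"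
    using q N mult_left_mono[OF N(2), of "2 / (2 * q - 1) * q ^ (N + 1)"] by simp
  finally have head: "\<bar>\<Sum>k<N. u k\<bar> \<le> 2 / (2 * q - 1) * q ^ (N + 1)" .
  have "norm (u (k + N)) \<le> 2 * q ^ (N + 1) * q ^ k" for k
    using fine[of "k + N"] by (simp add: power_add mult_ac)
  moreover have "summable (\<lambda>k. 2 * q ^ (N + 1) * q ^ k)"
    using q by (intro summable_mult summable_geometric) auto
  ultimately have "\<bar>\<Sum>k. u (k + N)\<bar> \<le> (\<Sum>k. 2 * q ^ (N + 1) * q ^ k)"
    using norm_suminf_le[of "\<lambda>k. u (k + N)" "\<lambda>k. 2 * q ^ (N + 1) * q ^ k"]
    unfolding real_norm_def by blast
  also have "\<dots> = 2 / (1 - q) * q ^ (N + 1)"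
    using q by (subst suminf_mult) (auto simp: suminf_geometric)
  finally have tail: "\<bar>\<Sum>k. u (k + N)\<bar> \<le> 2 / (1 - q) * q ^ (N + 1)" .
  show "\<bar>suminf u\<bar> \<le> (2 / (2 * q - 1) + 2 / (1 - q)) * q ^ (N + 1)"
    using head tail suminf_split_initial_segment[OF su, of N] unfolding distrib_right by linarith
qed

definition schauder_series :: "real \<Rightarrow> (nat \<Rightarrow> nat \<Rightarrow> real) \<Rightarrow> real \<Rightarrow> real" where
  "schauder_series q \<epsilon> t = (\<Sum>k. q ^ (k + 1) * signed_tents (\<epsilon> k) (2 ^ k * t))"

lemma schauder_series_summable:
  assumes "0 < q" "q < 1" "\<And>k n. \<bar>\<epsilon> k n\<bar> \<le> 1"
  shows "summable (\<lambda>k. q ^ (k + 1) * signed_tents (\<epsilon> k) (2 ^ k * t))"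
proof (rule summable_comparison_test'[of "\<lambda>k. q * q ^ k" 0])
  show "summable (\<lambda>k. q * q ^ k)"
    using assms by (intro summable_mult summable_geometric) auto
  show "norm (q ^ (k + 1) * signed_tents (\<epsilon> k) (2 ^ k * t)) \<le> q * q ^ k" for k
    using assms abs_signed_tents(1)[of "\<epsilon> k"] mult_left_mono[of _ 1 "q * q ^ k"]
    by (simp add: abs_mult)
qed

lemma schauder_series_holder:
  assumes "0 < \<beta>" "\<beta> < 1" and \<epsilon>: "\<And>k n. \<bar>\<epsilon> k n\<bar> \<le> 1"
  defines "q \<equiv> 2 powr (- \<beta>)"
  assumes "s \<in> {0..1}" "t \<in> {0..1}"
  shows "\<bar>schauder_series q \<epsilon> s - schauder_series q \<epsilon> t\<bar>
    \<le> (2 / (2 * q - 1) + 2 / (1 - q)) * \<bar>s - t\<bar> powr \<beta>"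
proof (cases "s = t")
  case False
  have q: "0 < q" "q < 1"
    using assms(1) powr_less_one[of 2 "- \<beta>"] by (auto simp: q_def)
  have "2 * q = 2 powr (1 - \<beta>)"
    by (simp add: q_def powr_diff powr_minus field_simps)
  also have "\<dots> > 1" using assms(2) by simp
  finally have q2: "1 < 2 * q" .
  let ?h = "\<bar>s - t\<bar>"
  have h: "0 < ?h" "?h \<le> 1" using assms False by auto
  obtain N where N: "?h * 2 ^ N \<le> 1" "1 < ?h * 2 ^ (N + 1)"
    using dyadic_magnitude[OF h] .
  let ?u = "\<lambda>k. q ^ (k + 1) * signed_tents (\<epsilon> k) (2 ^ k * s) - q ^ (k + 1) * signed_tents (\<epsilon> k) (2 ^ k * t)"
  have u: "\<bar>?u k\<bar> = q ^ (k + 1) * \<bar>signed_tents (\<epsilon> k) (2 ^ k * s) - signed_tents (\<epsilon> k) (2 ^ k * t)\<bar>" for k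
    using q by (simp add: right_diff_distrib[symmetric] abs_mult)
  have "schauder_series q \<epsilon> s - schauder_series q \<epsilon> t = suminf ?u"
    unfolding schauder_series_def
    by (intro suminf_diff schauder_series_summable q \<epsilon>)
  also have "\<bar>\<dots>\<bar> \<le> (2 / (2 * q - 1) + 2 / (1 - q)) * q ^ (N + 1)"
  proof (rule two_scale_sum_bound(2)[OF q q2 _ N(1)])
    fix k
    have "\<bar>signed_tents (\<epsilon> k) (2 ^ k * s) - signed_tents (\<epsilon> k) (2 ^ k * t)\<bar> \<le> 2 ^ (k + 1) * ?h"
      using signed_tents_lipschitz[of "\<epsilon> k" "2 ^ k * s" "2 ^ k * t", OF \<epsilon>]
      by (simp add: right_diff_distrib[symmetric] abs_mult)
    then show "\<bar>?u k\<bar> \<le> q ^ (k + 1) * (2 ^ (k + 1) * ?h)"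
      unfolding u using q by (intro mult_left_mono) auto
    have "\<bar>signed_tents (\<epsilon> k) (2 ^ k * s) - signed_tents (\<epsilon> k) (2 ^ k * t)\<bar> \<le> 2"
      using abs_signed_tents(1)[of "\<epsilon> k" "2 ^ k * s", OF \<epsilon>]
        abs_signed_tents(1)[of "\<epsilon> k" "2 ^ k * t", OF \<epsilon>] by linarith
    then show "\<bar>?u k\<bar> \<le> 2 * q ^ (k + 1)"
      unfolding u using q mult_left_mono[of _ 2 "q ^ (k + 1)"] by (simp add: mult.commute)
  qed simp
  also have "\<dots> \<le> (2 / (2 * q - 1) + 2 / (1 - q)) * ?h powr \<beta>"
  proof (rule mult_left_mono)
    have "q ^ (N + 1) = (1 / 2 ^ (N + 1)) powr \<beta>"
      by (simp only: q_def inverse_power_two_powr)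
    also have "\<dots> \<le> ?h powr \<beta>"
      using N(2) assms(1) by (intro powr_mono2) (auto simp: field_simps)
    finally show "q ^ (N + 1) \<le> ?h powr \<beta>" .
  qed (use q q2 in auto)
  finally show ?thesis .
qed simp

text \<open>Tents of coarser levels are affine on the cell \<open>j\<close> of level \<open>m\<close>, and tents of finer
  levels vanish at its two end points and its midpoint. Only the peak of the tent over the cell
  itself is left.\<close>

lemma schauder_series_second_difference:
  assumes "0 < q" "q < 1" "\<And>k n. \<bar>\<epsilon> k n\<bar> \<le> 1"
  shows "schauder_series q \<epsilon> (dyadic (Suc m) (2 * j)) + schauder_series q \<epsilon> (dyadic (Suc m) (2 * j + 2))
    - 2 * schauder_series q \<epsilon> (dyadic (Suc m) (2 * j + 1)) = - 2 * q ^ (m + 1) * \<epsilon> m j"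
proof -
  let ?t = "\<lambda>i. dyadic (Suc m) (2 * j + i)"
  let ?s = "\<lambda>k i. signed_tents (\<epsilon> k) (2 ^ k * ?t i)"
  let ?u = "\<lambda>k. q ^ (k + 1) * ?s k 0 + q ^ (k + 1) * ?s k 2 - 2 * (q ^ (k + 1) * ?s k 1)"
  have sums: "(\<lambda>k. q ^ (k + 1) * ?s k i) sums schauder_series q \<epsilon> (?t i)" for i
    unfolding schauder_series_def by (rule summable_sums[OF schauder_series_summable[OF assms]])
  have "schauder_series q \<epsilon> (?t 0) + schauder_series q \<epsilon> (?t 2) - 2 * schauder_series q \<epsilon> (?t 1) = suminf ?u"
    by (rule sums_unique[OF sums_diff[OF sums_add[OF sums[of 0] sums[of 2]] sums_mult[OF sums[of 1]]]])
  also have "\<dots> = sum ?u {m}"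
  proof (rule suminf_finite)
    fix k assume "k \<notin> {m}"
    then consider "k < m" | "m < k" by fastforce
    then have "?s k 0 + ?s k 2 - 2 * ?s k 1 = 0"
    proof cases
      case 1
      then obtain e where e: "m = Suc (k + e)"
        by (auto simp: less_iff_Suc_add)
      \<comment> \<open>In the scale of level \<open>k\<close> the cell lies in the half-integer cell number \<open>n\<close>.\<close>
      define n where "n = j div 2 ^ e"
      have n1: "n * 2 ^ e \<le> j"
        unfolding n_def by (rule div_times_less_eq_dividend)
      have n2: "j + 1 \<le> (n + 1) * 2 ^ e"
        unfolding n_def using dividend_less_div_times[of "2 ^ e" j] by simp
      have x: "2 ^ k * ?t 0 = real j / 2 ^ e / 2" "2 ^ k * ?t 2 = real (j + 1) / 2 ^ e / 2"
        "2 ^ k * ?t 1 = (2 ^ k * ?t 0 + 2 ^ k * ?t 2) / 2"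
        by (simp_all add: e dyadic_def power_add field_simps)
      have "real (n * 2 ^ e) \<le> real j"
        using n1 by (rule of_nat_mono)
      then have l: "real n \<le> real j / 2 ^ e"
        by (simp add: le_divide_eq)
      have "real (j + 1) \<le> real ((n + 1) * 2 ^ e)"
        using n2 by (rule of_nat_mono)
      then have r: "real (j + 1) / 2 ^ e \<le> real (Suc n)"
        by (simp add: divide_le_eq algebra_simps)
      have lr: "real j / 2 ^ e \<le> real (j + 1) / 2 ^ e"
        by (simp add: divide_right_mono)
      have "?s k 0 + ?s k 2 = 2 * ?s k 1"
        unfolding x(3)
      proof (rule signed_tents_midpoint[of n])
        show "real n / 2 \<le> 2 ^ k * ?t 0"
          unfolding x(1) by (rule divide_right_mono[OF l]) simp
        show "real n / 2 \<le> 2 ^ k * ?t 2"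
          unfolding x(2) by (rule divide_right_mono[OF order_trans[OF l lr]]) simp
        show "2 ^ k * ?t 0 \<le> real (Suc n) / 2"
          unfolding x(1) by (rule divide_right_mono[OF order_trans[OF lr r]]) simp
        show "2 ^ k * ?t 2 \<le> real (Suc n) / 2"
          unfolding x(2) by (rule divide_right_mono[OF r]) simp
      qed
      then show ?thesis by simp
    next
      case 2
      then obtain e where e: "k = Suc (m + e)"
        by (auto simp: less_iff_Suc_add)
      have "2 ^ k * ?t i = real (2 ^ e * (2 * j + i))" for i
        by (simp add: e dyadic_def power_add)
      then show ?thesis
        by (simp only: signed_tents_of_nat)
    qed
    moreover have "?u k = q ^ (k + 1) * (?s k 0 + ?s k 2 - 2 * ?s k 1)"
      by (simp add: algebra_simps)
    ultimately show "?u k = 0" by (simp only: mult_zero_right)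
  qed simp
  also have "\<dots> = - 2 * q ^ (m + 1) * \<epsilon> m j"
  proof -
    have "2 ^ m * ?t 0 = real j" "2 ^ m * ?t 2 = real (Suc j)" "2 ^ m * ?t 1 = real j + 1 / 2"
      by (simp_all add: dyadic_def field_simps)
    then have "?s m 0 = 0" "?s m 2 = 0" "?s m 1 = \<epsilon> m j"
      using signed_tents_up[of j "real j + 1 / 2" "\<epsilon> m"] by (simp_all only: signed_tents_of_nat) simp
    then show ?thesis by (simp del: power_Suc)
  qed
  finally show ?thesis by simp
qed


section \<open>Cells inside an interval\<close>

lemma summation_by_parts:
  fixes F :: "nat \<Rightarrow> 'a \<Rightarrow> real"
  assumes "M \<le> N"
  shows "(\<Sum>n = M + 1..N. F n (h n) - F n (h (n - 1)))
    = F (Suc N) (h N) - F M (h M) - (\<Sum>n\<in>{M..<Suc N}. F (Suc n) (h n) - F n (h n))"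
  using assms
proof (induction N rule: dec_induct)
  case (step N)
  have "{M + 1..Suc N} = insert (Suc N) {M + 1..N}"
    using step.hyps by auto
  then show ?case
    using step by (simp add: atLeastLessThanSuc)
qed (simp add: atLeastLessThanSuc)

lemma sum_pairs:
  fixes u :: "nat \<Rightarrow> real"
  shows "(\<Sum>n\<in>{2 * p..<2 * r}. u n) = (\<Sum>j\<in>{p..<r}. u (2 * j) + u (2 * j + 1))"
proof (induction r)
  case (Suc r)
  show ?case
  proof (cases "p \<le> r")
    case True
    then show ?thesis using Suc by (simp add: atLeastLessThanSuc)
  next
    case False
    then show ?thesis by simp
  qed
qed simp

text \<open>The cells of level \<open>m\<close> inside \<open>[a,b]\<close> are those with index in
  \<open>{first_cell a m..<end_cell b m}\<close>.\<close>

definition first_cell :: "real \<Rightarrow> nat \<Rightarrow> nat" where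
  "first_cell a m = nat \<lceil>a * 2 ^ m\<rceil>"

definition end_cell :: "real \<Rightarrow> nat \<Rightarrow> nat" where
  "end_cell b m = nat \<lfloor>b * 2 ^ m\<rfloor>"

lemma end_cell_le:
  assumes "b \<le> 1" shows "end_cell b m \<le> 2 ^ m"
proof -
  have "b * 2 ^ m \<le> 2 ^ m" using assms by simp
  then have "\<lfloor>b * 2 ^ m\<rfloor> \<le> \<lfloor>(2::real) ^ m\<rfloor>" by (rule floor_mono)
  then show ?thesis by (simp add: end_cell_def nat_le_iff)
qed

lemma dyadic_indices_eq:
  assumes "0 \<le> a" "a < b" "b \<le> 1"
  shows "dyadic_indices a b (Suc m) = {2 * first_cell a m..<2 * end_cell b m}"
proof -
  have cell: "{dyadic m j..dyadic m (j + 1)} \<subseteq> {a..b} \<longleftrightarrow> first_cell a m \<le> j \<and> j < end_cell b m" for j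
  proof -
    have "{dyadic m j..dyadic m (j + 1)} \<subseteq> {a..b} \<longleftrightarrow> a \<le> dyadic m j \<and> dyadic m (j + 1) \<le> b"
      using dyadic_le_Suc[of m j] by simp
    moreover have "a \<le> dyadic m j \<longleftrightarrow> first_cell a m \<le> j"
      by (simp add: dyadic_def first_cell_def field_simps ceiling_le_iff nat_le_iff)
    moreover have "dyadic m (j + 1) \<le> b \<longleftrightarrow> j < end_cell b m"
    proof -
      have "dyadic m (j + 1) \<le> b \<longleftrightarrow> of_int (int j + 1) \<le> b * 2 ^ m"
        by (simp add: dyadic_def field_simps)
      also have "\<dots> \<longleftrightarrow> int j + 1 \<le> \<lfloor>b * 2 ^ m\<rfloor>"
        by (rule le_floor_iff[symmetric])
      also have "\<dots> \<longleftrightarrow> j < end_cell b m"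
        unfolding end_cell_def by linarith
      finally show ?thesis .
    qed
    ultimately show ?thesis by simp
  qed
  show ?thesis
  proof (rule set_eqI)
    fix n
    have "n \<in> dyadic_indices a b (Suc m) \<longleftrightarrow>
        n \<le> 2 ^ Suc m \<and> first_cell a m \<le> n div 2 \<and> n div 2 < end_cell b m"
      unfolding dyadic_indices_def diff_Suc_1 cell by (rule mem_Collect_eq)
    also have "\<dots> \<longleftrightarrow> 2 * first_cell a m \<le> n \<and> n < 2 * end_cell b m"
      using end_cell_le[OF assms(3), of m] unfolding power_Suc by linarith
    finally show "n \<in> dyadic_indices a b (Suc m) \<longleftrightarrow> n \<in> {2 * first_cell a m..<2 * end_cell b m}"
      unfolding atLeastLessThan_iff .
  qed
qed

text \<open>Compared with the children of the cells in \<open>[a,b]\<close>, the next level can gain one cell at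
  either end.\<close>

lemma first_cell_Suc: "2 * first_cell a m \<le> first_cell a (Suc m) + 1" "first_cell a (Suc m) \<le> 2 * first_cell a m"
proof -
  have "a * 2 ^ Suc m = 2 * (a * 2 ^ m)" by simp
  then show "2 * first_cell a m \<le> first_cell a (Suc m) + 1"
    "first_cell a (Suc m) \<le> 2 * first_cell a m"
    unfolding first_cell_def by linarith+
qed

lemma end_cell_Suc: "2 * end_cell b m \<le> end_cell b (Suc m)" "end_cell b (Suc m) \<le> 2 * end_cell b m + 1"
proof -
  have "b * 2 ^ Suc m = 2 * (b * 2 ^ m)" by simp
  then show "2 * end_cell b m \<le> end_cell b (Suc m)"
    "end_cell b (Suc m) \<le> 2 * end_cell b m + 1"
    unfolding end_cell_def by linarith+
qed

lemma dyadic_first_cell: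
  assumes "0 \<le> a" shows "\<bar>dyadic m (first_cell a m) - a\<bar> \<le> 1 / 2 ^ m"
proof -
  have "0 \<le> a * 2 ^ m" using assms by simp
  then have "\<bar>real (first_cell a m) - a * 2 ^ m\<bar> \<le> 1"
    unfolding first_cell_def by linarith
  then have "\<bar>(real (first_cell a m) - a * 2 ^ m) / 2 ^ m\<bar> \<le> 1 / 2 ^ m"
    by (simp add: abs_divide divide_right_mono)
  then show ?thesis by (simp add: dyadic_def diff_divide_distrib)
qed

lemma dyadic_end_cell:
  assumes "0 \<le> b" shows "\<bar>dyadic m (end_cell b m) - b\<bar> \<le> 1 / 2 ^ m"
proof -
  have "0 \<le> b * 2 ^ m" using assms by simp
  then have "\<bar>real (end_cell b m) - b * 2 ^ m\<bar> \<le> 1"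
    unfolding end_cell_def by linarith
  then have "\<bar>(real (end_cell b m) - b * 2 ^ m) / 2 ^ m\<bar> \<le> 1 / 2 ^ m"
    by (simp add: abs_divide divide_right_mono)
  then show ?thesis by (simp add: dyadic_def diff_divide_distrib)
qed

lemma half_power_tendsto: "(\<lambda>m. 1 / 2 ^ m :: real) \<longlonglongrightarrow> 0"
  using LIMSEQ_realpow_zero[of "1 / 2 :: real"] by (simp add: power_one_over)

lemma tendsto_of_dyadic_error:
  fixes t :: real
  assumes "\<And>m. \<bar>x m - t\<bar> \<le> 1 / 2 ^ m"
  shows "x \<longlonglongrightarrow> t"
proof -
  have "(\<lambda>m. x m - t) \<longlonglongrightarrow> 0"
    by (rule Lim_null_comparison[OF always_eventually half_power_tendsto]) (simp add: assms)
  then show ?thesis by (rule LIM_zero_cancel)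
qed

lemma tendsto_dyadic_first_cell: "0 \<le> a \<Longrightarrow> (\<lambda>m. dyadic m (first_cell a m)) \<longlonglongrightarrow> a"
  by (intro tendsto_of_dyadic_error dyadic_first_cell)

lemma tendsto_dyadic_end_cell: "0 \<le> b \<Longrightarrow> (\<lambda>m. dyadic m (end_cell b m)) \<longlonglongrightarrow> b"
  by (intro tendsto_of_dyadic_error dyadic_end_cell)

lemma eventually_first_less_end:
  assumes "0 \<le> a" "a < b"
  shows "\<forall>\<^sub>F m in sequentially. first_cell a m < end_cell b m"
proof -
  have "(\<lambda>m. dyadic m (end_cell b m) - dyadic m (first_cell a m)) \<longlonglongrightarrow> b - a"
    using assms by (intro tendsto_intros tendsto_dyadic_first_cell tendsto_dyadic_end_cell) auto
  then have "\<forall>\<^sub>F m in sequentially. dyadic m (end_cell b m) - dyadic m (first_cell a m) > 0"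
    using assms by (intro order_tendstoD) auto
  then show ?thesis
    by (rule eventually_mono) (simp add: dyadic_def diff_divide_distrib[symmetric] zero_less_divide_iff)
qed

section \<open>Reduction of the integral to cell sums\<close>

locale dyadic_integrand =
  fixes f :: "real \<times> real \<Rightarrow> real" and g :: "real \<Rightarrow> real" and \<alpha> \<beta> c d L C :: real
  assumes \<alpha>_pos: "0 < \<alpha>" and \<beta>_pos: "0 < \<beta>" and L_nonneg: "0 \<le> L" and C_nonneg: "0 \<le> C"
    and g_holder: "\<And>s t. s \<in> {0..1} \<Longrightarrow> t \<in> {0..1} \<Longrightarrow> \<bar>g s - g t\<bar> \<le> L * \<bar>s - t\<bar> powr \<alpha>"
    and g_range: "g ` {0..1} \<subseteq> {c..d}"
    and f_cont: "continuous_on ({0..1} \<times> UNIV) f"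
    and f_holder: "\<And>x s t. x \<in> {c..d} \<Longrightarrow> s \<in> {0..1} \<Longrightarrow> t \<in> {0..1} \<Longrightarrow>
      \<bar>f (s, x) - f (t, x)\<bar> \<le> C * \<bar>s - t\<bar> powr \<beta>"
begin

text \<open>An antiderivative of the integrand in its second variable. Starting at \<open>c\<close> makes it vanish
  there, so that bounds on rectangle increments contain bounds on \<open>F t x - F s x\<close>.\<close>

definition F :: "real \<Rightarrow> real \<Rightarrow> real" where
  "F t x = integral {c..x} (\<lambda>u. f (t, u))"

definition incr :: "nat \<Rightarrow> nat \<Rightarrow> real \<Rightarrow> real" where
  "incr k n x = F (dyadic k (Suc n)) x - F (dyadic k n) x"

definition cell_sum :: "nat \<Rightarrow> nat \<Rightarrow> nat \<Rightarrow> real" where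
  "cell_sum k p r = (\<Sum>n\<in>{p..<r}. incr k n (height g k n))"

lemma g_cont: "continuous_on {0..1} g"
  using continuous_on_holder \<alpha>_pos g_holder .

lemma height_range: "n < 2 ^ k \<Longrightarrow> height g k n \<in> {c..d}"
  using height_between[OF g_cont, of n k c d] g_range dyadic_cell_subset[of n k]
  by (fastforce simp: image_subset_iff)

lemma height_near:
  assumes "n < 2 ^ k" "t \<in> {0..1}"
  shows "\<bar>height g k n - g t\<bar> \<le> L * (\<bar>dyadic k n - t\<bar> + 1 / 2 ^ k) powr \<alpha>"
proof -
  let ?e = "L * (\<bar>dyadic k n - t\<bar> + 1 / 2 ^ k) powr \<alpha>"
  have "g t - ?e \<le> g u \<and> g u \<le> g t + ?e" if "u \<in> {dyadic k n..dyadic k (Suc n)}" for u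
  proof -
    have "\<bar>u - t\<bar> \<le> \<bar>dyadic k n - t\<bar> + 1 / 2 ^ k"
      using that dyadic_Suc_diff[of k n] by auto
    then have "L * \<bar>u - t\<bar> powr \<alpha> \<le> ?e"
      using L_nonneg \<alpha>_pos by (intro mult_left_mono powr_mono2) auto
    moreover have "u \<in> {0..1}" using that dyadic_cell_subset[OF assms(1)] by blast
    ultimately show ?thesis using g_holder[of u t] assms(2) by linarith
  qed
  then show ?thesis
    using height_between[OF g_cont assms(1), of "g t - ?e" "g t + ?e"] by (simp add: abs_le_iff)
qed

lemma height_tendsto:
  assumes "t \<in> {0..1}" "\<forall>\<^sub>F m in sequentially. n m < 2 ^ Suc m" "(\<lambda>m. dyadic (Suc m) (n m)) \<longlonglongrightarrow> t"
  shows "(\<lambda>m. height g (Suc m) (n m)) \<longlonglongrightarrow> g t"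
proof -
  have "(\<lambda>m. L * (\<bar>dyadic (Suc m) (n m) - t\<bar> + 1 / 2 ^ Suc m) powr \<alpha>)
      \<longlonglongrightarrow> L * (\<bar>t - t\<bar> + 0) powr \<alpha>"
    using assms(3) \<alpha>_pos LIMSEQ_Suc[OF half_power_tendsto]
    by (intro tendsto_intros tendsto_powr') auto
  then have lim: "(\<lambda>m. L * (\<bar>dyadic (Suc m) (n m) - t\<bar> + 1 / 2 ^ Suc m) powr \<alpha>) \<longlonglongrightarrow> 0"
    using \<alpha>_pos by simp
  have "(\<lambda>m. height g (Suc m) (n m) - g t) \<longlonglongrightarrow> 0"
    by (rule Lim_null_comparison[OF _ lim], rule eventually_mono[OF assms(2)])
      (simp only: real_norm_def height_near assms(1))
  then show ?thesis by (rule LIM_zero_cancel)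
qed

lemma f_cont_section: "t \<in> {0..1} \<Longrightarrow> continuous_on X (\<lambda>u. f (t, u))"
  by (rule continuous_on_compose2[OF f_cont]) (auto intro!: continuous_intros)

lemma F_diff:
  assumes "t \<in> {0..1}" "c \<le> x" "x \<le> y"
  shows "F t y - F t x = integral {x..y} (\<lambda>u. f (t, u))"
  using Henstock_Kurzweil_Integration.integral_combine[OF assms(2,3), of "\<lambda>u. f (t, u)"]
    integrable_continuous_real[OF f_cont_section[OF assms(1)]]
  unfolding F_def by (simp add: algebra_simps)

lemma F_at_left [simp]: "F t c = 0"
  by (simp add: F_def)

lemma interval_integral_eq_F_diff:
  assumes "t \<in> {0..1}" "x \<in> {c..d}" "y \<in> {c..d}"
  shows "(LBINT u=x..y. f (t, u)) = F t y - F t x"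
proof -
  have le: "(LBINT u=x..y. f (t, u)) = F t y - F t x" if "c \<le> x" "x \<le> y" for x y
    using interval_integral_eq_integral[OF that(2) borel_integrable_atLeastAtMost'[OF f_cont_section[OF assms(1)]]]
    by (simp only: F_diff[OF assms(1) that])
  show ?thesis
    using le[of x y] le[of y x] interval_integral_endpoints_reverse[of x y "\<lambda>u. f (t, u)"] assms
    by (cases "x \<le> y") auto
qed

lemma F_rectangle:
  assumes "s \<in> {0..1}" "t \<in> {0..1}" "x \<in> {c..d}" "y \<in> {c..d}"
  shows "\<bar>(F t y - F s y) - (F t x - F s x)\<bar> \<le> C * \<bar>t - s\<bar> powr \<beta> * \<bar>y - x\<bar>"
  using assms(3,4)
proof (induction x y rule: linorder_wlog)
  case (le x y)
  have "(F t y - F s y) - (F t x - F s x) = integral {x..y} (\<lambda>u. f (t, u)) - integral {x..y} (\<lambda>u. f (s, u))"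
    using F_diff[OF assms(1), of x y] F_diff[OF assms(2), of x y] le by simp
  also have "\<dots> = integral {x..y} (\<lambda>u. f (t, u) - f (s, u))"
    by (intro Henstock_Kurzweil_Integration.integral_diff[symmetric] integrable_continuous_real
        f_cont_section assms)
  also have "\<bar>\<dots>\<bar> \<le> C * \<bar>t - s\<bar> powr \<beta> * (y - x)"
    using le assms f_holder
    by (intro integral_bound[where 'a = real, unfolded real_norm_def] continuous_on_diff f_cont_section) auto
  finally show ?case using le by simp
next
  case (sym x y)
  then show ?case by (simp add: abs_minus_commute)
qed

lemma F_tendsto:
  assumes "t \<in> {0..1}" "y \<in> {c..d}" "s \<longlonglongrightarrow> t" "x \<longlonglongrightarrow> y"
    and ev: "\<forall>\<^sub>F m in sequentially. s m \<in> {0..1} \<and> x m \<in> {c..d}"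
  shows "(\<lambda>m. F (s m) (x m)) \<longlonglongrightarrow> F t y"
proof -
  have "compact ((\<lambda>u. f (t, u)) ` {c..d})"
    by (intro compact_continuous_image f_cont_section assms) auto
  then have "bounded ((\<lambda>u. f (t, u)) ` {c..d})"
    by (rule compact_imp_bounded)
  then obtain M where "\<forall>v\<in>(\<lambda>u. f (t, u)) ` {c..d}. \<bar>v\<bar> \<le> M"
    unfolding bounded_real ..
  then have M: "\<bar>f (t, u)\<bar> \<le> M" if "u \<in> {c..d}" for u
    using that by blast
  have lip: "\<bar>F t v - F t u\<bar> \<le> M * \<bar>v - u\<bar>" if "u \<in> {c..d}" "v \<in> {c..d}" for u v
    using that
  proof (induction u v rule: linorder_wlog)
    case (le u v)
    have "\<bar>integral {u..v} (\<lambda>w. f (t, w))\<bar> \<le> M * (v - u)"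
      using le M
      by (intro integral_bound[where 'a = real, unfolded real_norm_def] f_cont_section assms) auto
    then show ?case using F_diff[OF assms(1), of u v] le by simp
  next
    case (sym u v)
    then show ?case by (simp add: abs_minus_commute)
  qed
  let ?E = "\<lambda>m. C * \<bar>s m - t\<bar> powr \<beta> * \<bar>x m - c\<bar> + M * \<bar>x m - y\<bar>"
  have "?E \<longlonglongrightarrow> C * \<bar>t - t\<bar> powr \<beta> * \<bar>y - c\<bar> + M * \<bar>y - y\<bar>"
    using assms(3,4) \<beta>_pos by (intro tendsto_intros tendsto_powr') auto
  then have lim: "?E \<longlonglongrightarrow> 0" using \<beta>_pos by simp
  have "(\<lambda>m. F (s m) (x m) - F t y) \<longlonglongrightarrow> 0"
  proof (rule Lim_null_comparison[OF _ lim], rule eventually_mono[OF ev])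
    fix m assume m: "s m \<in> {0..1} \<and> x m \<in> {c..d}"
    have "c \<in> {c..d}" using assms(2) by auto
    then show "norm (F (s m) (x m) - F t y) \<le> ?E m"
      using F_rectangle[of t "s m" c "x m"] lip[of y "x m"] m assms(1,2)
      unfolding F_at_left real_norm_def by linarith
  qed
  then show ?thesis by (rule LIM_zero_cancel)
qed

lemma incr_diff_bound:
  assumes "n < 2 ^ k" "x \<in> {c..d}" "y \<in> {c..d}"
  shows "\<bar>incr k n y - incr k n x\<bar> \<le> C * (2 powr - \<beta>) ^ k * \<bar>y - x\<bar>"
  using F_rectangle[of "dyadic k n" "dyadic k (Suc n)" x y] assms dyadic_in_unit[of n k] dyadic_in_unit[of "Suc n" k]
  by (simp add: incr_def dyadic_Suc_diff inverse_power_two_powr)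

text \<open>This is the rectangle bound over the whole strip between \<open>c\<close> and \<open>x\<close>. It controls the few
  cells at the ends of \<open>[a,b]\<close>.\<close>

lemma incr_bound:
  assumes "n < 2 ^ k" "x \<in> {c..d}"
  shows "\<bar>incr k n x\<bar> \<le> C * (2 powr - \<beta>) ^ k * (d - c)"
proof -
  have "\<bar>incr k n x\<bar> \<le> C * (2 powr - \<beta>) ^ k * \<bar>x - c\<bar>"
    using incr_diff_bound[OF assms(1), of c x] assms(2) by (simp add: incr_def)
  also have "\<dots> \<le> C * (2 powr - \<beta>) ^ k * (d - c)"
    using assms(2) C_nonneg by (intro mult_left_mono) auto
  finally show ?thesis .
qed

lemma incr_double: "incr k j x = incr (Suc k) (2 * j) x + incr (Suc k) (2 * j + 1) x"
proof -
  have "dyadic (Suc k) (Suc (2 * j + 1)) = dyadic k (Suc j)"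
    using dyadic_double[of k "Suc j"] by simp
  then show ?thesis
    by (simp only: incr_def dyadic_double) simp
qed

text \<open>Halving a cell does not change its increment as long as the height is kept, so only the passage
  from the mean height to the heights of the two halves contributes.\<close>

lemma cell_sum_refine:
  "cell_sum (Suc m) (2 * p) (2 * r) - cell_sum m p r = (\<Sum>j\<in>{p..<r}.
    (incr (Suc m) (2 * j) (height g (Suc m) (2 * j)) - incr (Suc m) (2 * j) (height g m j)) +
    (incr (Suc m) (2 * j + 1) (height g (Suc m) (2 * j + 1)) - incr (Suc m) (2 * j + 1) (height g m j)))"
  unfolding cell_sum_def sum_pairs sum_subtractf[symmetric]
  by (rule sum.cong[OF refl]) (subst incr_double[of m], simp)

text \<open>The mean height lies half a jump away from the heights of both halves; the two rectangles of a
  cell therefore add up to its whole jump, and the sum of the jumps is \<open>2\<^bsup>m+1\<^esup>\<close> times the area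
  between the step curves.\<close>

lemma cell_sum_refine_bound:
  assumes "r \<le> 2 ^ m"
  shows "\<bar>cell_sum (Suc m) (2 * p) (2 * r) - cell_sum m p r\<bar>
    \<le> C * ((2 powr - \<beta>) ^ Suc m * 2 ^ Suc m * step_area g m)"
proof -
  let ?q = "(2 powr - \<beta>) ^ Suc m"
  let ?\<delta> = "\<lambda>j. \<bar>height g (Suc m) (2 * j + 1) - height g (Suc m) (2 * j)\<bar>"
  have "\<bar>cell_sum (Suc m) (2 * p) (2 * r) - cell_sum m p r\<bar> \<le> (\<Sum>j\<in>{p..<r}. C * ?q * ?\<delta> j)"
    unfolding cell_sum_refine
  proof (rule order_trans[OF sum_abs sum_mono])
    fix j assume "j \<in> {p..<r}"
    then have j: "j < 2 ^ m" using assms by auto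
    have h: "height g m j \<in> {c..d}" "height g (Suc m) (2 * j) \<in> {c..d}" "height g (Suc m) (2 * j + 1) \<in> {c..d}"
      using j by (auto intro!: height_range simp del: atLeastAtMost_iff)
    have half: "\<bar>height g (Suc m) (2 * j) - height g m j\<bar> = ?\<delta> j / 2"
      "\<bar>height g (Suc m) (2 * j + 1) - height g m j\<bar> = ?\<delta> j / 2"
      unfolding height_is_mean[OF g_cont j] by (simp_all add: field_simps abs_if)
    have "\<bar>incr (Suc m) (2 * j) (height g (Suc m) (2 * j)) - incr (Suc m) (2 * j) (height g m j)\<bar>
        \<le> C * ?q * (?\<delta> j / 2)"
      using incr_diff_bound[of "2 * j" "Suc m", OF _ h(1,2)] j unfolding half(1) by simp
    moreover have "\<bar>incr (Suc m) (2 * j + 1) (height g (Suc m) (2 * j + 1)) - incr (Suc m) (2 * j + 1) (height g m j)\<bar>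
        \<le> C * ?q * (?\<delta> j / 2)"
      using incr_diff_bound[of "2 * j + 1" "Suc m", OF _ h(1,3)] j unfolding half(2) by simp
    ultimately show "\<bar>(incr (Suc m) (2 * j) (height g (Suc m) (2 * j)) - incr (Suc m) (2 * j) (height g m j)) +
      (incr (Suc m) (2 * j + 1) (height g (Suc m) (2 * j + 1)) - incr (Suc m) (2 * j + 1) (height g m j))\<bar>
        \<le> C * ?q * ?\<delta> j" by linarith
  qed
  also have "\<dots> \<le> (\<Sum>j<2 ^ m. C * ?q * ?\<delta> j)"
    using assms C_nonneg by (intro sum_mono2) auto
  also have "\<dots> = C * (?q * 2 ^ Suc m * step_area g m)"
    by (simp add: step_area_def sum_distrib_left[symmetric])
  finally show ?thesis .
qed

lemma cell_sum_boundary_bound: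
  assumes "0 \<le> a" "b \<le> 1"
  shows "\<bar>cell_sum (Suc m) (first_cell a (Suc m)) (end_cell b (Suc m))
      - cell_sum (Suc m) (2 * first_cell a m) (2 * end_cell b m)\<bar>
    \<le> 2 * (C * (2 powr - \<beta>) ^ Suc m * (d - c))"
proof -
  let ?A = "{first_cell a (Suc m)..<end_cell b (Suc m)}" and ?B = "{2 * first_cell a m..<2 * end_cell b m}"
  let ?w = "\<lambda>n. incr (Suc m) n (height g (Suc m) n)"
  let ?K = "C * (2 powr - \<beta>) ^ Suc m * (d - c)"
  have sub: "?B \<subseteq> ?A" and diff: "?A - ?B \<subseteq> {2 * first_cell a m - 1, 2 * end_cell b m}"
    using first_cell_Suc[of a m] end_cell_Suc[of b m] by auto
  have K: "0 \<le> ?K"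
    using C_nonneg height_range[of 0 0] by auto
  have "\<bar>sum ?w ?A - sum ?w ?B\<bar> = \<bar>sum ?w (?A - ?B)\<bar>"
    using sum_diff[OF _ sub, of ?w] by simp
  also have "\<dots> \<le> (\<Sum>n\<in>?A - ?B. ?K)"
    using end_cell_le[OF assms(2), of "Suc m"]
    by (intro order_trans[OF sum_abs sum_mono] incr_bound height_range) auto
  also have "\<dots> \<le> 2 * ?K"
  proof -
    have "card (?A - ?B) \<le> card {2 * first_cell a m - 1, 2 * end_cell b m}"
      using diff by (intro card_mono) auto
    also have "\<dots> \<le> 2"
      by (simp add: card_insert_if)
    finally have "card (?A - ?B) \<le> 2" .
    then show ?thesis using K by (simp add: mult_right_mono del: power_Suc)
  qed
  finally show ?thesis unfolding cell_sum_def .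
qed

text \<open>The dyadic sum of level \<open>Suc m\<close> runs over both halves of every cell of level \<open>m\<close> in
  \<open>[a,b]\<close> except the very first half, whose jump from outside is omitted. This is exactly the
  range for which summation by parts gives a cell sum over complete pairs of halves.\<close>

lemma dyadic_sum_eq:
  assumes "0 \<le> a" "a < b" "b \<le> 1" and less: "first_cell a m < end_cell b m"
  shows "dyadic_sum f g a b (Suc m) =
    F (dyadic m (end_cell b m)) (height g (Suc m) (2 * end_cell b m - 1))
    - F (dyadic m (first_cell a m)) (height g (Suc m) (2 * first_cell a m))
    - cell_sum (Suc m) (2 * first_cell a m) (2 * end_cell b m)"
proof -
  let ?M = "2 * first_cell a m" and ?N = "2 * end_cell b m - 1"
  have N: "Suc ?N = 2 * end_cell b m" "?M \<le> ?N" "?N < 2 ^ Suc m"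
    using less end_cell_le[OF assms(3), of m] by auto
  have idx: "dyadic_indices a b (Suc m) = {?M..?N}"
    unfolding dyadic_indices_eq[OF assms(1-3)] using N by auto
  then have "dyadic_sum f g a b (Suc m) = (\<Sum>n = ?M + 1..?N.
      (LBINT x=height g (Suc m) (n - 1)..height g (Suc m) n. f (dyadic (Suc m) n, x)))"
    using N(2) Min_eqI[of "{?M..?N}" ?M] Max_eqI[of "{?M..?N}" ?N]
    unfolding dyadic_sum_def idx by auto
  also have "\<dots> = (\<Sum>n = ?M + 1..?N.
      F (dyadic (Suc m) n) (height g (Suc m) n) - F (dyadic (Suc m) n) (height g (Suc m) (n - 1)))"
    using N(3) by (intro sum.cong refl interval_integral_eq_F_diff dyadic_in_unit height_range) auto
  also have "\<dots> = F (dyadic (Suc m) (Suc ?N)) (height g (Suc m) ?N)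
      - F (dyadic (Suc m) ?M) (height g (Suc m) ?M) - cell_sum (Suc m) ?M (Suc ?N)"
    unfolding cell_sum_def incr_def
    by (rule summation_by_parts[OF N(2), of "\<lambda>n. F (dyadic (Suc m) n)"])
  finally show ?thesis
    by (simp only: N(1) dyadic_double)
qed

text \<open>Continuity of \<open>F\<close> and convergence of the heights make the boundary terms of the summation by
  parts converge to \<open>F b (g b) - F a (g a)\<close>, for every integrand and every interval.\<close>

lemma integral_exists_iff:
  assumes ab: "0 \<le> a" "a < b" "b \<le> 1"
  shows "dyadic_integral_exists f g a b \<longleftrightarrow>
    convergent (\<lambda>m. cell_sum (Suc m) (2 * first_cell a m) (2 * end_cell b m))"
proof -
  let ?P = "first_cell a" and ?R = "end_cell b"
  let ?S = "\<lambda>m. dyadic_sum f g a b (Suc m)" and ?T = "\<lambda>m. cell_sum (Suc m) (2 * ?P m) (2 * ?R m)"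
  let ?L = "\<lambda>m. F (dyadic m (?P m)) (height g (Suc m) (2 * ?P m))"
  let ?U = "\<lambda>m. F (dyadic m (?R m)) (height g (Suc m) (2 * ?R m - 1))"
  note R_le = end_cell_le[OF ab(3)]
  note ev = eventually_first_less_end[OF ab(1,2)]
  have P_lim: "(\<lambda>m. dyadic m (?P m)) \<longlonglongrightarrow> a"
    by (rule tendsto_dyadic_first_cell[OF ab(1)])
  have "0 \<le> b" using ab by simp
  then have R_lim: "(\<lambda>m. dyadic m (?R m)) \<longlonglongrightarrow> b"
    by (rule tendsto_dyadic_end_cell)
  have idx: "2 * ?P m < 2 ^ Suc m" "2 * ?R m - 1 < 2 ^ Suc m" "?P m \<le> 2 ^ m" "1 \<le> ?R m"
    if "?P m < ?R m" for m
    using that R_le[of m] by simp_all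
  note evP = eventually_mono[OF ev idx(1)] and evR = eventually_mono[OF ev idx(2)]
  have hP: "(\<lambda>m. height g (Suc m) (2 * ?P m)) \<longlonglongrightarrow> g a"
    by (rule height_tendsto[OF _ evP]) (use ab P_lim in \<open>simp_all add: dyadic_double\<close>)
  have "(\<lambda>m. dyadic m (?R m) - 1 / 2 ^ Suc m) \<longlonglongrightarrow> b - 0"
    by (intro tendsto_diff R_lim LIMSEQ_Suc[OF half_power_tendsto])
  moreover have "\<forall>\<^sub>F m in sequentially. dyadic m (?R m) - 1 / 2 ^ Suc m = dyadic (Suc m) (2 * ?R m - 1)"
  proof (rule eventually_mono[OF ev])
    fix m assume "?P m < ?R m"
    then have "real (2 * ?R m - 1) = 2 * real (?R m) - 1"
      by (simp add: of_nat_diff)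
    then show "dyadic m (?R m) - 1 / 2 ^ Suc m = dyadic (Suc m) (2 * ?R m - 1)"
      by (simp add: dyadic_def diff_divide_distrib)
  qed
  ultimately have "(\<lambda>m. dyadic (Suc m) (2 * ?R m - 1)) \<longlonglongrightarrow> b"
    using Lim_transform_eventually by fastforce
  then have hR: "(\<lambda>m. height g (Suc m) (2 * ?R m - 1)) \<longlonglongrightarrow> g b"
    by (intro height_tendsto[OF _ evR]) (use ab in simp_all)
  have g: "g a \<in> {c..d}" "g b \<in> {c..d}"
    using ab by (auto intro!: subsetD[OF g_range] simp del: atLeastAtMost_iff) auto
  have L_lim: "?L \<longlonglongrightarrow> F a (g a)"
  proof (rule F_tendsto[OF _ g(1) P_lim hP])
    show "\<forall>\<^sub>F m in sequentially. dyadic m (?P m) \<in> {0..1} \<and> height g (Suc m) (2 * ?P m) \<in> {c..d}"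
      using ev by (rule eventually_mono) (intro conjI dyadic_in_unit height_range idx)
  qed (use ab in simp)
  have U_lim: "?U \<longlonglongrightarrow> F b (g b)"
  proof (rule F_tendsto[OF _ g(2) R_lim hR])
    show "\<forall>\<^sub>F m in sequentially. dyadic m (?R m) \<in> {0..1} \<and> height g (Suc m) (2 * ?R m - 1) \<in> {c..d}"
      using ev by (rule eventually_mono) (intro conjI dyadic_in_unit height_range idx R_le)
  qed (use ab in simp)
  have D_lim: "(\<lambda>m. ?U m - ?L m) \<longlonglongrightarrow> F b (g b) - F a (g a)"
    by (intro tendsto_diff U_lim L_lim)
  have eq: "\<forall>\<^sub>F m in sequentially. ?S m = (?U m - ?L m) - ?T m"
    using ev by (rule eventually_mono) (rule dyadic_sum_eq[OF ab])
  have "convergent ?S \<longleftrightarrow> convergent (\<lambda>m. (?U m - ?L m) - ?T m)"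
    using eq by (rule convergent_cong)
  also have "\<dots> \<longleftrightarrow> convergent ?T"
  proof
    assume "convergent (\<lambda>m. (?U m - ?L m) - ?T m)"
    then have "convergent (\<lambda>m. (?U m - ?L m) - ((?U m - ?L m) - ?T m))"
      by (rule convergent_diff[OF convergentI[OF D_lim]])
    then show "convergent ?T" by simp
  next
    assume "convergent ?T"
    then show "convergent (\<lambda>m. (?U m - ?L m) - ?T m)"
      by (rule convergent_diff[OF convergentI[OF D_lim]])
  qed
  finally show ?thesis
    unfolding dyadic_integral_exists_def has_dyadic_integral_def convergent_def
    by (simp only: filterlim_sequentially_Suc)
qed

section \<open>Convergence of the area series is sufficient\<close>

text \<open>The sequence \<open>?U\<close> uses all cells of level \<open>m\<close> in \<open>[a,b]\<close>, and \<open>?T\<close> uses the halves of these cells.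
  The step from \<open>?U m\<close> to \<open>?T m\<close> costs area, the step from \<open>?T m\<close> to \<open>?U (Suc m)\<close> costs at
  most two cells at the ends.\<close>

lemma integral_exists:
  assumes "0 \<le> a" "a < b" "b \<le> 1"
    and area: "summable (\<lambda>m. (2 powr - \<beta>) ^ Suc m * 2 ^ Suc m * step_area g m)"
  shows "dyadic_integral_exists f g a b"
proof -
  let ?q = "2 powr - \<beta>"
  let ?U = "\<lambda>m. cell_sum m (first_cell a m) (end_cell b m)"
  let ?T = "\<lambda>m. cell_sum (Suc m) (2 * first_cell a m) (2 * end_cell b m)"
  let ?A = "\<lambda>m. C * (?q ^ Suc m * 2 ^ Suc m * step_area g m)"
  let ?B = "\<lambda>m. 2 * (C * ?q ^ Suc m * (d - c))"
  have A: "summable ?A" by (rule summable_mult[OF area])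
  have "summable (\<lambda>m. ?q ^ m)"
    using \<beta>_pos powr_less_one[of 2 "- \<beta>"] by (intro summable_geometric) auto
  then have B: "summable ?B"
    by (intro summable_mult summable_mult2) (simp only: summable_Suc_iff)
  have TU: "\<bar>?T m - ?U m\<bar> \<le> ?A m" for m
    by (intro cell_sum_refine_bound end_cell_le assms)
  have UT: "\<bar>?U (Suc m) - ?T m\<bar> \<le> ?B m" for m
    by (intro cell_sum_boundary_bound assms)
  have "\<bar>?U (Suc m) - ?U m\<bar> \<le> ?A m + ?B m" for m
    using TU[of m] UT[of m] by linarith
  then have "summable (\<lambda>m. ?U (Suc m) - ?U m)"
    by (intro summable_comparison_test'[OF summable_add[OF A B], of 0]) auto
  then have "convergent (\<lambda>n. \<Sum>m<n. ?U (Suc m) - ?U m)"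
    by (simp only: summable_iff_convergent)
  then have "convergent (\<lambda>n. ?U n - ?U 0)"
    unfolding sum_lessThan_telescope[of ?U] .
  then have U: "convergent ?U"
    using convergent_add[OF _ convergent_const[of "?U 0"]] by fastforce
  have "(\<lambda>m. ?T m - ?U m) \<longlonglongrightarrow> 0"
    by (rule Lim_null_comparison[OF always_eventually summable_LIMSEQ_zero[OF A]]) (use TU in auto)
  then have "convergent (\<lambda>m. ?T m - ?U m)"
    by (rule convergentI)
  from convergent_add[OF U this] have "convergent ?T" by simp
  then show ?thesis
    using integral_exists_iff assms by blast
qed

end

lemma series_term_eq:
  "2 powr (real (k + 1) * (1 - \<beta>)) * A = (2 powr - \<beta>) ^ Suc k * 2 ^ Suc k * A"
  for \<beta> A :: real
proof -
  have "(2 powr - \<beta>) ^ Suc k * 2 ^ Suc k = (2 powr - \<beta> * 2 powr 1) ^ Suc k"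
    by (simp only: power_mult_distrib) simp
  also have "\<dots> = (2 powr (1 - \<beta>)) ^ Suc k"
    by (simp only: powr_add[symmetric]) simp
  also have "\<dots> = 2 powr (real (k + 1) * (1 - \<beta>))"
    by (subst powr_power) simp_all
  finally show ?thesis by simp
qed

section \<open>Convergence of the area series is necessary\<close>

text \<open>The signs of the tents are those of the jumps of the heights between the halves of the cells, so
  that all contributions of the refinement steps have the same sign and nothing cancels.\<close>

lemma schauder_test_integrand:
  fixes g :: "real \<Rightarrow> real"
  assumes "0 < \<alpha>" "0 < \<beta>" "\<beta> < 1" "0 \<le> L"
    and g_holder: "\<And>s t. s \<in> {0..1} \<Longrightarrow> t \<in> {0..1} \<Longrightarrow> \<bar>g s - g t\<bar> \<le> L * \<bar>s - t\<bar> powr \<alpha>"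
    and g_range: "g ` {0..1} \<subseteq> {c..d}"
  obtains \<phi> C where "0 \<le> C"
    and "\<forall>s\<in>{0..1}. \<forall>t\<in>{0..1}. \<bar>\<phi> s - \<phi> t\<bar> \<le> C * \<bar>s - t\<bar> powr \<beta>"
    and "continuous_on ({0..1} \<times> UNIV) (\<lambda>z :: real \<times> real. \<phi> (fst z))"
    and "dyadic_integral_exists (\<lambda>z. \<phi> (fst z)) g 0 1 \<longrightarrow>
      summable (\<lambda>m. (2 powr - \<beta>) ^ Suc m * 2 ^ Suc m * step_area g m)"
proof -
  let ?q = "2 powr - \<beta>"
  define \<epsilon> where "\<epsilon> k j = sgn (height g (Suc k) (2 * j + 1) - height g (Suc k) (2 * j))" for k j
  define \<phi> where "\<phi> = schauder_series ?q \<epsilon>"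
  define C where "C = 2 / (2 * ?q - 1) + 2 / (1 - ?q)"
  have \<epsilon>: "\<bar>\<epsilon> k j\<bar> \<le> 1" for k j by (simp add: \<epsilon>_def sgn_if)
  have q: "0 < ?q" "?q < 1" using assms powr_less_one[of 2 "- \<beta>"] by auto
  have holder: "\<bar>\<phi> s - \<phi> t\<bar> \<le> C * \<bar>s - t\<bar> powr \<beta>" if "s \<in> {0..1}" "t \<in> {0..1}" for s t
    unfolding \<phi>_def C_def using schauder_series_holder[of \<beta> \<epsilon> s t] assms \<epsilon> that by blast
  have C: "0 \<le> C"
    using holder[of 0 1] by simp
  have cont: "continuous_on ({0..1} \<times> UNIV) (\<lambda>z::real \<times> real. \<phi> (fst z))"
    by (rule continuous_on_compose2[OF continuous_on_holder[OF \<open>0 < \<beta>\<close> holder, of "{0..1}"]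
          continuous_on_fst[OF continuous_on_id]]) auto
  interpret dyadic_integrand "\<lambda>z. \<phi> (fst z)" g \<alpha> \<beta> c d L C
    by (rule dyadic_integrand.intro; (simp only: fst_conv)?)
      (fact assms(1) assms(2) assms(4) C g_holder g_range cont | (rule holder; assumption))+
  have F: "F t x = \<phi> t * (x - c)" if "c \<le> x" for t x
    using that by (simp add: F_def)
  \<comment> \<open>On the whole interval every cell of level \<open>m + 1\<close> has its parent inside, so there are no end effects.\<close>
  let ?U = "\<lambda>m. cell_sum m 0 (2 ^ m)"
  let ?A = "\<lambda>m. ?q ^ Suc m * 2 ^ Suc m * step_area g m"
  have step: "?U (Suc m) - ?U m = - ?A m" for m
  proof -
    let ?\<delta> = "\<lambda>j. height g (Suc m) (2 * j + 1) - height g (Suc m) (2 * j)"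
    have "?U (Suc m) - ?U m = (\<Sum>j\<in>{0..<2 ^ m}. - (?q ^ Suc m * \<bar>?\<delta> j\<bar>))"
      using cell_sum_refine[of m 0 "2 ^ m"] unfolding mult_0_right power_Suc[symmetric]
    proof (elim trans, intro sum.cong refl)
      fix j assume "j \<in> {0..<2 ^ m :: nat}"
      then have j: "j < 2 ^ m" by simp
      let ?t = "\<lambda>i. \<phi> (dyadic (Suc m) (2 * j + i))"
      let ?h = "\<lambda>i. height g (Suc m) (2 * j + i)"
      have h: "c \<le> height g m j" "c \<le> ?h 0" "c \<le> ?h 1"
        using height_range[OF j] height_range[of "2 * j" "Suc m"] height_range[of "2 * j + 1" "Suc m"] j by auto
      have "(incr (Suc m) (2 * j) (?h 0) - incr (Suc m) (2 * j) (height g m j)) +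
          (incr (Suc m) (2 * j + 1) (?h 1) - incr (Suc m) (2 * j + 1) (height g m j))
        = (?t 1 - ?t 0) * (?h 0 - height g m j) + (?t 2 - ?t 1) * (?h 1 - height g m j)"
        using h by (simp add: incr_def F algebra_simps)
      \<comment> \<open>The mean height is half a jump above one height and half a jump below the other,
        which turns the two first differences into a second difference.\<close>
      also have "\<dots> = (?t 0 + ?t 2 - 2 * ?t 1) * (?\<delta> j / 2)"
        unfolding height_is_mean[OF g_cont j] by (simp add: field_simps)
      also have "?t 0 + ?t 2 - 2 * ?t 1 = - 2 * ?q ^ (m + 1) * \<epsilon> m j"
        using schauder_series_second_difference[of ?q \<epsilon> m j, OF q \<epsilon>] by (simp add: \<phi>_def)
      also have "\<dots> * (?\<delta> j / 2) = - (?q ^ Suc m * \<bar>?\<delta> j\<bar>)"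
        by (simp add: \<epsilon>_def abs_sgn mult_ac)
      finally show "(incr (Suc m) (2 * j) (height g (Suc m) (2 * j)) - incr (Suc m) (2 * j) (height g m j)) +
          (incr (Suc m) (2 * j + 1) (height g (Suc m) (2 * j + 1)) - incr (Suc m) (2 * j + 1) (height g m j))
        = - (?q ^ Suc m * \<bar>?\<delta> j\<bar>)" by simp
    qed
    also have "\<dots> = - ?A m"
      by (simp add: step_area_def sum_negf sum_distrib_left[symmetric] atLeast0LessThan)
    finally show ?thesis .
  qed
  show thesis
  proof (rule that[OF C _ cont], use holder in blast, rule impI)
    assume "dyadic_integral_exists (\<lambda>z. \<phi> (fst z)) g 0 1"
    then have "convergent (\<lambda>m. cell_sum (Suc m) (2 * first_cell 0 m) (2 * end_cell 1 m))"
      by (subst (asm) integral_exists_iff) simp_all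
    moreover have "2 * first_cell 0 m = 0" "2 * end_cell 1 m = 2 ^ Suc m" for m
      by (simp_all add: first_cell_def end_cell_def nat_power_eq)
    ultimately have "convergent (\<lambda>m. ?U (Suc m))"
      by (simp only:)
    then have "convergent ?U" by (subst (asm) convergent_Suc_iff)
    then have "convergent (\<lambda>m. ?U 0 - ?U m)"
      by (intro convergent_diff convergent_const)
    moreover have "?U 0 - ?U n = (\<Sum>m<n. ?A m)" for n
    proof -
      have "?U n - ?U 0 = (\<Sum>m<n. ?U (Suc m) - ?U m)"
        by (rule sum_lessThan_telescope[symmetric])
      also have "\<dots> = - (\<Sum>m<n. ?A m)"
        unfolding step by (rule sum_negf)
      finally show ?thesis by linarith
    qed
    ultimately show "summable ?A"
      by (simp only: summable_iff_convergent)
  qed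
qed

section \<open>The characterization\<close>

theorem theorem2p2:
  fixes \<alpha> \<beta> c d :: real and g :: "real \<Rightarrow> real"
  assumes "0 < \<alpha>" "\<alpha> < 1" "0 < \<beta>" "\<beta> < 1"
    and "g \<in> holder_class \<alpha>"
    and "g ` {0..1} \<subseteq> {c..d}"
  shows "(\<forall>f :: real \<times> real \<Rightarrow> real.
            continuous_on ({0..1} \<times> UNIV) f \<and>
            (SUP x\<in>{c..d}. holder_seminorm \<beta> (\<lambda>t. f (t, x))) < \<infinity> \<longrightarrow>
            (\<forall>a b. 0 \<le> a \<and> a < b \<and> b \<le> 1 \<longrightarrow> dyadic_integral_exists f g a b))
         \<longleftrightarrow> summable (\<lambda>k. 2 powr (real (k + 1) * (1 - \<beta>)) * step_area g k)"
    (is "?exist \<longleftrightarrow> ?area")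
proof -
  have "(SUP x\<in>{()}. holder_seminorm \<alpha> g) < \<infinity>"
    using assms(5) by (simp add: holder_class_def)
  then obtain L where L: "0 \<le> L"
    "\<And>s t. s \<in> {0..1} \<Longrightarrow> t \<in> {0..1} \<Longrightarrow> \<bar>g s - g t\<bar> \<le> L * \<bar>s - t\<bar> powr \<alpha>"
    by (rule uniform_holder_constant) blast
  show ?thesis
    unfolding series_term_eq
  proof
    assume area: "summable (\<lambda>k. (2 powr - \<beta>) ^ Suc k * 2 ^ Suc k * step_area g k)"
    show ?exist
    proof (intro allI impI; elim conjE)
      fix f :: "real \<times> real \<Rightarrow> real" and a b :: real
      assume f: "continuous_on ({0..1} \<times> UNIV) f"
        "(SUP x\<in>{c..d}. holder_seminorm \<beta> (\<lambda>t. f (t, x))) < \<infinity>"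
        and ab: "0 \<le> a" "a < b" "b \<le> 1"
      obtain C where C: "0 \<le> C" "\<And>x s t. x \<in> {c..d} \<Longrightarrow> s \<in> {0..1} \<Longrightarrow> t \<in> {0..1} \<Longrightarrow>
          \<bar>f (s, x) - f (t, x)\<bar> \<le> C * \<bar>s - t\<bar> powr \<beta>"
        using uniform_holder_constant[OF f(2)] by blast
      interpret dyadic_integrand f g \<alpha> \<beta> c d L C
        by (rule dyadic_integrand.intro, rule assms(1), rule assms(3), rule L(1), rule C(1),
            rule L(2), assumption+, rule assms(6), rule f(1), rule C(2), assumption+)
      show "dyadic_integral_exists f g a b"
        by (rule integral_exists[OF ab area])
    qed
  next
    assume exist: ?exist
    obtain \<phi> C where "0 \<le> C"
      and \<phi>: "\<forall>s\<in>{0..1}. \<forall>t\<in>{0..1}. \<bar>\<phi> s - \<phi> t\<bar> \<le> C * \<bar>s - t\<bar> powr \<beta>"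
        "continuous_on ({0..1} \<times> UNIV) (\<lambda>z :: real \<times> real. \<phi> (fst z))"
        "dyadic_integral_exists (\<lambda>z. \<phi> (fst z)) g 0 1 \<longrightarrow>
          summable (\<lambda>k. (2 powr - \<beta>) ^ Suc k * 2 ^ Suc k * step_area g k)"
      by (rule schauder_test_integrand[OF assms(1,3,4) L assms(6)]) (assumption | rule that)+
    have "holder_seminorm \<beta> \<phi> \<le> ennreal C"
      unfolding holder_seminorm_le_iff[OF \<open>0 \<le> C\<close>] by (rule \<phi>(1))
    then have "(SUP x\<in>{c..d}. holder_seminorm \<beta> \<phi>) \<le> ennreal C"
      by (intro SUP_least)
    then have "(SUP x\<in>{c..d}. holder_seminorm \<beta> \<phi>) < \<infinity>"
      by (rule le_less_trans) simp
    then have "continuous_on ({0..1} \<times> UNIV) (\<lambda>z :: real \<times> real. \<phi> (fst z)) \<and>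
        (SUP x\<in>{c..d}. holder_seminorm \<beta> (\<lambda>t. \<phi> (fst (t, x)))) < \<infinity>"
      using \<phi>(2) unfolding fst_conv by (intro conjI)
    from exist[THEN spec, THEN mp, OF this]
    have "dyadic_integral_exists (\<lambda>z. \<phi> (fst z)) g 0 1"
      by (elim allE[of _ 0] allE[of _ 1]) simp
    then show "summable (\<lambda>k. (2 powr - \<beta>) ^ Suc k * 2 ^ Suc k * step_area g k)"
      by (rule \<phi>(3)[rule_format])
  qed
qed

end
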